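(* Every finite group $G$ is permutation stable of degree $\le 2$ ($P_2$-stable).
   Context: For groups $G,H$, a map $f:G\to H$ and $g\in G$, define $\partial_g f:G\to H$ by $(\partial_g f)(x)=f(gx)f(x)^{-1}$, and put $\partial_{g_1,\ldots,g_k}f=\partial_{g_1}(\partial_{g_2}(\cdots\partial_{g_k}f))$. The map $f$ is polynomial of degree $\le s$ if $(\partial_{g_1,\ldots,g_{s+1}}f)(x)=1$ for all $x,g_1,\ldots,g_{s+1}\in G$. It is unital if $f(1)=1$. $\mathrm{Sym}(n)$ carries the normalized Hamming distance $d_n(\sigma,\tau)=1-\frac1n|\mathrm{Fix}(\sigma^{-1}\tau)|$. A sequence of maps $f_n:G\to\mathrm{Sym}(m_n)$ ($m_n$ positive integers) is asymptotically unital if $\lim_n d_{m_n}(f_n(1),1)=0$. An asymptotically unital sequence is almost-polynomial of degree $\le s$ if $\lim_n d_{m_n}((\partial_{g_1,\ldots,g_{s+1}}f_n)(1),1)=0$ for all $g_1,\ldots,g_{s+1}\in G$. $G$ is $P_s$-stable if for every almost-polynomial sequence $(f_n)_n$ of degree $\le s$ of $G$ there are unital polynomial maps $\rho_n:G\to\mathrm{Sym}(m_n)$ of degree $\le s$ with $\lim_n d_{m_n}(\rho_n(g),f_n(g))=0$ for all $g\in G$. *)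

theory Defs
  imports Complex_Main "HOL-Algebra.Sym_Groups"
begin

text \<open>Groups are carrier-based, so maps between them are total functions of which only the
  values on the carrier matter.\<close>

definition finite_diff ::
    "('a, 'c) monoid_scheme \<Rightarrow> ('b, 'd) monoid_scheme \<Rightarrow> 'a \<Rightarrow> ('a \<Rightarrow> 'b) \<Rightarrow> 'a \<Rightarrow> 'b" where
  "finite_diff G H g f = (\<lambda>x. f (g \<otimes>\<^bsub>G\<^esub> x) \<otimes>\<^bsub>H\<^esub> inv\<^bsub>H\<^esub> (f x))"

text \<open>The head of the list is the outermost difference: for the list \<open>[g1, ..., gk]\<close> this is
  the difference along \<open>g1\<close> of the difference along \<open>g2\<close> of ... of the difference along \<open>gk\<close>
  of \<open>f\<close>.\<close>

definition iter_diff ::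
    "('a, 'c) monoid_scheme \<Rightarrow> ('b, 'd) monoid_scheme \<Rightarrow> 'a list \<Rightarrow> ('a \<Rightarrow> 'b) \<Rightarrow> 'a \<Rightarrow> 'b" where
  "iter_diff G H gs f = foldr (finite_diff G H) gs f"

definition polynomial_map ::
    "('a, 'c) monoid_scheme \<Rightarrow> ('b, 'd) monoid_scheme \<Rightarrow> nat \<Rightarrow> ('a \<Rightarrow> 'b) \<Rightarrow> bool" where
  "polynomial_map G H s f \<longleftrightarrow>
     f \<in> carrier G \<rightarrow> carrier H \<and>
     (\<forall>x\<in>carrier G. \<forall>gs. set gs \<subseteq> carrier G \<and> length gs = s + 1 \<longrightarrow>
        iter_diff G H gs f x = \<one>\<^bsub>H\<^esub>)"

definition unital_map ::
    "('a, 'c) monoid_scheme \<Rightarrow> ('b, 'd) monoid_scheme \<Rightarrow> ('a \<Rightarrow> 'b) \<Rightarrow> bool" where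
  "unital_map G H f \<longleftrightarrow> f \<one>\<^bsub>G\<^esub> = \<one>\<^bsub>H\<^esub>"

text \<open>\<^const>\<open>sym_group\<close> \<open>n\<close> acts on \<open>{1..n}\<close>, and its elements fix every other natural number;
  the fixed points therefore have to be counted inside \<open>{1..n}\<close>.\<close>

definition hamming_dist :: "nat \<Rightarrow> (nat \<Rightarrow> nat) \<Rightarrow> (nat \<Rightarrow> nat) \<Rightarrow> real" where
  "hamming_dist n \<sigma> \<tau> =
     1 - real (card {i \<in> {1..n}. (inv\<^bsub>sym_group n\<^esub> \<sigma> \<otimes>\<^bsub>sym_group n\<^esub> \<tau>) i = i}) / real n"

definition asymptotically_unital ::
    "('a, 'c) monoid_scheme \<Rightarrow> (nat \<Rightarrow> nat) \<Rightarrow> (nat \<Rightarrow> 'a \<Rightarrow> nat \<Rightarrow> nat) \<Rightarrow> bool" where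
  "asymptotically_unital G m f \<longleftrightarrow>
     (\<forall>n. m n > 0) \<and>
     (\<forall>n. f n \<in> carrier G \<rightarrow> carrier (sym_group (m n))) \<and>
     (\<lambda>n. hamming_dist (m n) (f n \<one>\<^bsub>G\<^esub>) \<one>\<^bsub>sym_group (m n)\<^esub>) \<longlonglongrightarrow> 0"

definition almost_polynomial ::
    "('a, 'c) monoid_scheme \<Rightarrow> nat \<Rightarrow> (nat \<Rightarrow> nat) \<Rightarrow> (nat \<Rightarrow> 'a \<Rightarrow> nat \<Rightarrow> nat) \<Rightarrow> bool" where
  "almost_polynomial G s m f \<longleftrightarrow>
     asymptotically_unital G m f \<and>
     (\<forall>gs. set gs \<subseteq> carrier G \<and> length gs = s + 1 \<longrightarrow>
        (\<lambda>n. hamming_dist (m n) (iter_diff G (sym_group (m n)) gs (f n) \<one>\<^bsub>G\<^esub>)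
               \<one>\<^bsub>sym_group (m n)\<^esub>) \<longlonglongrightarrow> 0)"

definition P_stable :: "nat \<Rightarrow> ('a, 'c) monoid_scheme \<Rightarrow> bool" where
  "P_stable s G \<longleftrightarrow>
     (\<forall>m f. almost_polynomial G s m f \<longrightarrow>
        (\<exists>\<rho>. (\<forall>n. unital_map G (sym_group (m n)) (\<rho> n) \<and>
                   polynomial_map G (sym_group (m n)) s (\<rho> n)) \<and>
             (\<forall>g\<in>carrier G. (\<lambda>n. hamming_dist (m n) (\<rho> n g) (f n g)) \<longlonglongrightarrow> 0)))"

end

theory Submission
  imports Defs "HOL-Algebra.Product_Groups"
begin

text \<open>A unital map \<open>F\<close> from \<open>G\<close> to \<open>H\<close> has degree at most 2 only if its defect
  \<open>c g x = F (g x) (F x)\<^sup>-\<^sup>1 (F g)\<^sup>-\<^sup>1\<close> is a homomorphism in \<open>x\<close> for every \<open>g\<close>. Associativity in \<open>G\<close> then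
  forces the values of \<open>c\<close> to commute and \<open>F\<close> to normalise the subgroup \<open>N\<close> that they generate.
  For finite \<open>G\<close>, \<open>N\<close> is generated by finitely many commuting finite subgroups, so \<open>N\<close> is finite and
  \<open>F\<close> generates a finite group, contained in \<open>N F(G)\<close>.

  An almost-polynomial sequence of degree at most 2 is an honest unital polynomial map into the
  product of the symmetric groups modulo the sequences that tend to the identity. Hence it
  factors through a finite group \<open>K\<close>, and a lift of \<open>K\<close> to the product is a sequence of almost
  homomorphisms. Finite groups are stable, so these are close to homomorphisms from \<open>K\<close>, whose
  compositions with the polynomial map into \<open>K\<close> are the required polynomial maps.\<close>

section \<open>Generated subgroups\<close>

lemma (in group) cancel_inv_left: "x \<in> carrier G \<Longrightarrow> y \<in> carrier G \<Longrightarrow> x \<otimes> (inv x \<otimes> y) = y"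
  by (simp flip: m_assoc)

lemma (in group) cancel_left_inv: "x \<in> carrier G \<Longrightarrow> y \<in> carrier G \<Longrightarrow> inv x \<otimes> (x \<otimes> y) = y"
  by (simp flip: m_assoc)

text \<open>Together these push a word into right-nested form and cancel adjacent inverse pairs, so
  \<open>simp\<close> can close equations between words with the same free reduction.\<close>

lemmas (in group) word_simps = m_assoc inv_mult_group cancel_inv_left cancel_left_inv

text \<open>The centraliser of \<open>z\<close> is a subgroup, so it suffices to look at
  generators.\<close>

lemma (in group) generate_commute:
  assumes S: "S \<subseteq> carrier G" and z: "z \<in> carrier G"
    and comm: "\<And>s. s \<in> S \<Longrightarrow> z \<otimes> s = s \<otimes> z"
    and t: "t \<in> generate G S"
  shows "z \<otimes> t = t \<otimes> z"
  using t
proof induction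
  case (inv h)
  then have h: "h \<in> carrier G" using S by auto
  have "z \<otimes> inv h = inv h \<otimes> (h \<otimes> z) \<otimes> inv h" using h z by (simp add: word_simps)
  also have "\<dots> = inv h \<otimes> (z \<otimes> h) \<otimes> inv h" using comm[OF inv] by simp
  also have "\<dots> = inv h \<otimes> z" using h z by (simp add: word_simps)
  finally show ?case .
next
  case (eng h1 h2)
  then have "h1 \<in> carrier G" "h2 \<in> carrier G" using generate_in_carrier[OF S] by auto
  with eng z show ?case by (metis m_assoc)
qed (use z comm in auto)

text \<open>Conjugation by \<open>a\<close> is an endomorphism, which reduces the claim to
  generators. Only one inclusion results; conjugation by \<open>inv a\<close> needs a separate
  argument.\<close>

lemma (in group) generate_conj_closed:
  assumes S: "S \<subseteq> carrier G" and a: "a \<in> carrier G"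
    and conj: "\<And>s. s \<in> S \<Longrightarrow> a \<otimes> s \<otimes> inv a \<in> generate G S"
    and t: "t \<in> generate G S"
  shows "a \<otimes> t \<otimes> inv a \<in> generate G S"
  using t
proof induction
  case one
  then show ?case using a by (simp add: generate.one)
next
  case (inv h)
  then have h: "h \<in> carrier G" using S by auto
  have "a \<otimes> inv h \<otimes> inv a = inv (a \<otimes> h \<otimes> inv a)" using h a by (simp add: word_simps)
  then show ?case using generate_m_inv_closed[OF S conj[OF inv]] by simp
next
  case (eng h1 h2)
  then have "h1 \<in> carrier G" "h2 \<in> carrier G" using generate_in_carrier[OF S] by auto
  then have "a \<otimes> (h1 \<otimes> h2) \<otimes> inv a = (a \<otimes> h1 \<otimes> inv a) \<otimes> (a \<otimes> h2 \<otimes> inv a)"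
    using a by (simp add: word_simps)
  then show ?case using generate.eng[OF eng.IH] by simp
qed (use conj in auto)

text \<open>Subgroups are added one at a time. The new \<open>A t\<close> commutes with the subgroup
  \<open>?N\<close> generated by the earlier ones, so the products of an element of
  \<open>A t\<close> and one of \<open>?N\<close> are closed under multiplication, and there are
  finitely many of them.\<close>

lemma (in group) finite_generate_commuting:
  assumes "finite T" and "\<And>t. t \<in> T \<Longrightarrow> subgroup (A t) G" and "\<And>t. t \<in> T \<Longrightarrow> finite (A t)"
    and "\<And>x y. x \<in> (\<Union>t\<in>T. A t) \<Longrightarrow> y \<in> (\<Union>t\<in>T. A t) \<Longrightarrow> x \<otimes> y = y \<otimes> x"
  shows "finite (generate G (\<Union>t\<in>T. A t))"
  using assms
proof (induction T)
  case empty
  then show ?case by (simp add: generate_empty)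
next
  case (insert t T)
  let ?S = "\<Union>t\<in>T. A t"
  let ?N = "generate G ?S"
  interpret A: subgroup "A t" G by (rule insert.prems(1)) simp
  have S: "?S \<subseteq> carrier G" using insert.prems(1)[THEN subgroup.subset] by auto
  interpret N: subgroup ?N G by (rule generate_is_subgroup[OF S])
  have comm: "a \<otimes> n = n \<otimes> a" if "a \<in> A t" "n \<in> ?N" for a n
    by (rule generate_commute[OF S _ _ that(2)]) (use that in \<open>auto intro!: insert.prems(3)\<close>)
  let ?X = "(\<lambda>(a, n). a \<otimes> n) ` (A t \<times> ?N)"
  have X: "a \<otimes> n \<in> ?X" if "a \<in> A t" "n \<in> ?N" for a n using that by force
  have gen: "x \<in> ?X" if "x \<in> A t \<union> ?S" for x
    using that
  proof
    assume "x \<in> A t"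
    then show ?thesis using X[of x \<one>] by simp
  next
    assume "x \<in> ?S"
    then show ?thesis using X[of \<one> x] S generate.incl[of x ?S] by auto
  qed
  have "generate G (\<Union>t\<in>insert t T. A t) \<subseteq> ?X"
  proof
    fix x assume "x \<in> generate G (\<Union>t\<in>insert t T. A t)"
    then show "x \<in> ?X"
    proof induction
      case one
      then show ?case using X[of \<one> \<one>] by simp
    next
      case (incl h)
      then show ?case using gen by simp
    next
      case (inv h)
      then consider "h \<in> A t" | s where "s \<in> T" "h \<in> A s" by auto
      then have "inv h \<in> A t \<union> ?S"
        using insert.prems(1)[THEN subgroup.m_inv_closed] by cases auto
      then show ?case by (rule gen)
    next
      case (eng x y)
      then obtain a n b k where *: "x = a \<otimes> n" "y = b \<otimes> k" "a \<in> A t" "b \<in> A t" "n \<in> ?N" "k \<in> ?N"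
        by auto
      then have "x \<otimes> y = a \<otimes> (n \<otimes> b) \<otimes> k" by (simp add: m_assoc)
      also have "\<dots> = a \<otimes> (b \<otimes> n) \<otimes> k" using comm[OF *(4,5)] by simp
      also have "\<dots> = (a \<otimes> b) \<otimes> (n \<otimes> k)" using * by (simp add: m_assoc)
      finally show ?case using * X[of "a \<otimes> b" "n \<otimes> k"] by auto
    qed
  qed
  moreover have "finite ?N"
    by (rule insert.IH) (use insert.prems in auto)
  ultimately show ?case using insert.prems(2)[of t] by (auto intro: finite_subset)
qed

section \<open>Polynomial maps\<close>

lemma iter_diff_Nil [simp]: "iter_diff G H [] f = f"
  by (simp add: iter_diff_def)

lemma iter_diff_Cons [simp]: "iter_diff G H (g # gs) f = finite_diff G H g (iter_diff G H gs f)"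
  by (simp add: iter_diff_def)

lemma iter_diff_closed:
  assumes "group G" "group H" "f \<in> carrier G \<rightarrow> carrier H" "set gs \<subseteq> carrier G"
  shows "iter_diff G H gs f \<in> carrier G \<rightarrow> carrier H"
proof -
  interpret G: group G by fact
  interpret H: group H by fact
  show ?thesis using assms(3,4) by (induction gs) (auto simp: finite_diff_def Pi_iff)
qed

text \<open>Homomorphisms commute with differences. This serves for coordinate projections, for the
  passage to a quotient and for the inclusion of a subgroup.\<close>

lemma iter_diff_hom:
  assumes "group G" "group H" "group K" "p \<in> hom H K" "f \<in> carrier G \<rightarrow> carrier H"
    and "set gs \<subseteq> carrier G" "x \<in> carrier G"
  shows "iter_diff G K gs (\<lambda>x. p (f x)) x = p (iter_diff G H gs f x)"
proof -
  interpret G: group G by fact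
  interpret p: group_hom H K p using assms by (simp add: group_hom_def group_hom_axioms_def)
  show ?thesis using assms(6,7)
  proof (induction gs arbitrary: x)
    case (Cons g gs)
    have "iter_diff G H gs f \<in> carrier G \<rightarrow> carrier H"
      using Cons.prems assms by (intro iter_diff_closed) auto
    then show ?case using Cons by (simp add: finite_diff_def Pi_iff)
  qed simp
qed

lemma polynomial_map_hom:
  assumes "group G" "group H" "group K" "p \<in> hom H K" "polynomial_map G H s f"
  shows "polynomial_map G K s (\<lambda>x. p (f x))"
proof -
  interpret p: group_hom H K p using assms by (simp add: group_hom_def group_hom_axioms_def)
  show ?thesis
    using assms iter_diff_hom[OF assms(1-4)] by (auto simp: polynomial_map_def Pi_iff)
qed

text \<open>If all first differences of a map \<open>?v\<close> vanish at the identity, then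
  \<open>?v\<close> is constant and its differences vanish everywhere. This bridges the gap between
  almost-polynomial sequences, tested only at the identity, and polynomial maps, tested at every
  point.\<close>

lemma polynomial_mapI_at_one:
  assumes "group G" "group H" and f: "f \<in> carrier G \<rightarrow> carrier H"
    and one: "\<And>gs. set gs \<subseteq> carrier G \<Longrightarrow> length gs = s + 1 \<Longrightarrow> iter_diff G H gs f \<one>\<^bsub>G\<^esub> = \<one>\<^bsub>H\<^esub>"
  shows "polynomial_map G H s f"
  unfolding polynomial_map_def
proof (intro conjI f ballI allI impI)
  interpret G: group G by fact
  interpret H: group H by fact
  fix x gs assume x: "x \<in> carrier G" and gs: "set gs \<subseteq> carrier G \<and> length gs = s + 1"
  then obtain h hs where hs: "gs = h # hs" "h \<in> carrier G" "set hs \<subseteq> carrier G" "length hs = s"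
    by (cases gs) auto
  let ?v = "iter_diff G H hs f"
  have v: "?v y \<in> carrier H" if "y \<in> carrier G" for y
    using iter_diff_closed[OF assms(1,2) f hs(3)] that by auto
  have *: "?v y = ?v \<one>\<^bsub>G\<^esub>" if "y \<in> carrier G" for y
    using one[of "y # hs"] that hs v H.inv_solve_right'[of "\<one>\<^bsub>H\<^esub>" "?v y" "?v \<one>\<^bsub>G\<^esub>"]
    by (simp add: finite_diff_def)
  show "iter_diff G H gs f x = \<one>\<^bsub>H\<^esub>"
    using *[of x] *[of "h \<otimes>\<^bsub>G\<^esub> x"] x hs v by (simp add: finite_diff_def)
qed

section \<open>Quadratic maps on finite groups\<close>

locale unital_quadratic = G: group G + H: group H
  for G :: "('a, 'c) monoid_scheme" (structure) and H :: "('b, 'd) monoid_scheme" (structure) +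
  fixes F :: "'a \<Rightarrow> 'b"
  assumes poly: "polynomial_map G H 2 F" and unital: "unital_map G H F"
begin

section \<open>The defect of a unital map of degree at most 2\<close>

definition c :: "'a \<Rightarrow> 'a \<Rightarrow> 'b" where
  "c g x = F (g \<otimes>\<^bsub>G\<^esub> x) \<otimes>\<^bsub>H\<^esub> inv\<^bsub>H\<^esub> (F x) \<otimes>\<^bsub>H\<^esub> inv\<^bsub>H\<^esub> (F g)"

lemma F_closed [simp]: "x \<in> carrier G \<Longrightarrow> F x \<in> carrier H"
  using poly by (auto simp: polynomial_map_def)

lemma F_one [simp]: "F \<one>\<^bsub>G\<^esub> = \<one>\<^bsub>H\<^esub>"
  using unital by (simp add: unital_map_def)

lemma c_closed [simp]: "g \<in> carrier G \<Longrightarrow> x \<in> carrier G \<Longrightarrow> c g x \<in> carrier H"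
  by (simp add: c_def)

lemma F_mult:
  "g \<in> carrier G \<Longrightarrow> x \<in> carrier G \<Longrightarrow> F (g \<otimes>\<^bsub>G\<^esub> x) = c g x \<otimes>\<^bsub>H\<^esub> F g \<otimes>\<^bsub>H\<^esub> F x"
  by (simp add: c_def H.word_simps)

text \<open>With \<open>u\<close> the difference of \<open>F\<close> along \<open>g\<close>,
  unitality gives \<open>u 1 = F g\<close>, so \<open>c g\<close> is \<open>u\<close> normalised on
  the right to be unital. As \<open>u\<close> has degree at most 1, this normalisation is a
  homomorphism.\<close>

lemma c_mult:
  assumes "g \<in> carrier G" "x \<in> carrier G" "y \<in> carrier G"
  shows "c g (x \<otimes>\<^bsub>G\<^esub> y) = c g x \<otimes>\<^bsub>H\<^esub> c g y"
proof -
  define u where "u = finite_diff G H g F"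
  have u: "u z \<in> carrier H" if "z \<in> carrier G" for z using that assms by (simp add: u_def finite_diff_def)
  have c: "c g z = u z \<otimes>\<^bsub>H\<^esub> inv\<^bsub>H\<^esub> (u \<one>\<^bsub>G\<^esub>)" if "z \<in> carrier G" for z
    using that assms by (simp add: c_def u_def finite_diff_def)
  \<comment> \<open>The innermost entry \<open>g\<close> produces \<open>u\<close>; the base point 1
    then compares the difference of \<open>u\<close> along \<open>x\<close> at \<open>y\<close> and
    at 1.\<close>
  have "iter_diff G H [y, x, g] F \<one>\<^bsub>G\<^esub> = \<one>\<^bsub>H\<^esub>"
    using poly assms unfolding polynomial_map_def by (simp del: iter_diff_Cons)
  then have "u (x \<otimes>\<^bsub>G\<^esub> y) \<otimes>\<^bsub>H\<^esub> inv\<^bsub>H\<^esub> (u y) \<otimes>\<^bsub>H\<^esub> inv\<^bsub>H\<^esub> (u x \<otimes>\<^bsub>H\<^esub> inv\<^bsub>H\<^esub> (u \<one>\<^bsub>G\<^esub>)) = \<one>\<^bsub>H\<^esub>"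
    using assms by (simp add: finite_diff_def u_def)
  then have "u (x \<otimes>\<^bsub>G\<^esub> y) \<otimes>\<^bsub>H\<^esub> inv\<^bsub>H\<^esub> (u y) = u x \<otimes>\<^bsub>H\<^esub> inv\<^bsub>H\<^esub> (u \<one>\<^bsub>G\<^esub>)"
    using assms u H.inv_solve_right'[of "\<one>\<^bsub>H\<^esub>"] by simp
  then have "u (x \<otimes>\<^bsub>G\<^esub> y) = u x \<otimes>\<^bsub>H\<^esub> inv\<^bsub>H\<^esub> (u \<one>\<^bsub>G\<^esub>) \<otimes>\<^bsub>H\<^esub> u y"
    using assms u H.inv_solve_right' by simp
  then show ?thesis using assms u by (simp add: c H.m_assoc)
qed

text \<open>Expand \<open>F\<close> of the product of \<open>g\<close>, \<open>h\<close>,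
  \<open>x\<close> in both bracketings, split \<open>c g (h x)\<close> by \<open>c_mult\<close>, and
  cancel \<open>F g\<close>, \<open>F h\<close>, \<open>F x\<close> on the right.\<close>

lemma conj_c:
  assumes "g \<in> carrier G" "h \<in> carrier G" "x \<in> carrier G"
  shows "F g \<otimes>\<^bsub>H\<^esub> c h x \<otimes>\<^bsub>H\<^esub> inv\<^bsub>H\<^esub> (F g) =
    inv\<^bsub>H\<^esub> (c g x) \<otimes>\<^bsub>H\<^esub> (inv\<^bsub>H\<^esub> (c g h) \<otimes>\<^bsub>H\<^esub> c (g \<otimes>\<^bsub>G\<^esub> h) x \<otimes>\<^bsub>H\<^esub> c g h)"
proof -
  have "c (g \<otimes>\<^bsub>G\<^esub> h) x \<otimes>\<^bsub>H\<^esub> c g h \<otimes>\<^bsub>H\<^esub> F g \<otimes>\<^bsub>H\<^esub> F h \<otimes>\<^bsub>H\<^esub> F x = F (g \<otimes>\<^bsub>G\<^esub> h \<otimes>\<^bsub>G\<^esub> x)"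
    using assms by (simp add: F_mult[of "g \<otimes>\<^bsub>G\<^esub> h" x] F_mult[of g h] H.m_assoc del: G.m_assoc)
  also have "\<dots> = F (g \<otimes>\<^bsub>G\<^esub> (h \<otimes>\<^bsub>G\<^esub> x))" using assms by (simp add: G.m_assoc)
  also have "\<dots> = c g h \<otimes>\<^bsub>H\<^esub> c g x \<otimes>\<^bsub>H\<^esub> F g \<otimes>\<^bsub>H\<^esub> c h x \<otimes>\<^bsub>H\<^esub> F h \<otimes>\<^bsub>H\<^esub> F x"
    using assms by (simp add: F_mult c_mult H.m_assoc)
  finally have *: "c (g \<otimes>\<^bsub>G\<^esub> h) x \<otimes>\<^bsub>H\<^esub> c g h \<otimes>\<^bsub>H\<^esub> F g \<otimes>\<^bsub>H\<^esub> F h \<otimes>\<^bsub>H\<^esub> F x = \<dots>" .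
  have "c (g \<otimes>\<^bsub>G\<^esub> h) x \<otimes>\<^bsub>H\<^esub> c g h = c (g \<otimes>\<^bsub>G\<^esub> h) x \<otimes>\<^bsub>H\<^esub> c g h \<otimes>\<^bsub>H\<^esub> F g \<otimes>\<^bsub>H\<^esub> F h \<otimes>\<^bsub>H\<^esub> F x
      \<otimes>\<^bsub>H\<^esub> inv\<^bsub>H\<^esub> (F g \<otimes>\<^bsub>H\<^esub> F h \<otimes>\<^bsub>H\<^esub> F x)"
    using assms by (simp add: H.word_simps)
  also have "\<dots> = c g h \<otimes>\<^bsub>H\<^esub> c g x \<otimes>\<^bsub>H\<^esub> (F g \<otimes>\<^bsub>H\<^esub> c h x \<otimes>\<^bsub>H\<^esub> inv\<^bsub>H\<^esub> (F g))"
    unfolding * using assms by (simp add: H.word_simps)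
  finally have **: "c (g \<otimes>\<^bsub>G\<^esub> h) x \<otimes>\<^bsub>H\<^esub> c g h = \<dots>" .
  have "inv\<^bsub>H\<^esub> (c g x) \<otimes>\<^bsub>H\<^esub> (inv\<^bsub>H\<^esub> (c g h) \<otimes>\<^bsub>H\<^esub> c (g \<otimes>\<^bsub>G\<^esub> h) x \<otimes>\<^bsub>H\<^esub> c g h) =
    inv\<^bsub>H\<^esub> (c g x) \<otimes>\<^bsub>H\<^esub> (inv\<^bsub>H\<^esub> (c g h) \<otimes>\<^bsub>H\<^esub> (c (g \<otimes>\<^bsub>G\<^esub> h) x \<otimes>\<^bsub>H\<^esub> c g h))"
    using assms by (simp add: H.m_assoc)
  then show ?thesis unfolding ** using assms by (simp add: H.word_simps)
qed

text \<open>The previous identity reads \<open>e(x) = a(x)\<^sup>-\<^sup>1 b(x)\<close> with \<open>e\<close>, \<open>a = c g\<close> and \<open>b\<close> all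
  homomorphisms in \<open>x\<close>; expanding \<open>b(x y) = a(x y) e(x y)\<close> forces \<open>e(x)\<close> to commute with
  every \<open>a(y)\<close>.\<close>

lemma c_commutes_conj:
  assumes g: "g \<in> carrier G" and h: "h \<in> carrier G" and x: "x \<in> carrier G" and y: "y \<in> carrier G"
  shows "c g y \<otimes>\<^bsub>H\<^esub> (F g \<otimes>\<^bsub>H\<^esub> c h x \<otimes>\<^bsub>H\<^esub> inv\<^bsub>H\<^esub> (F g)) = (F g \<otimes>\<^bsub>H\<^esub> c h x \<otimes>\<^bsub>H\<^esub> inv\<^bsub>H\<^esub> (F g)) \<otimes>\<^bsub>H\<^esub> c g y"
proof -
  define e where "e z = F g \<otimes>\<^bsub>H\<^esub> c h z \<otimes>\<^bsub>H\<^esub> inv\<^bsub>H\<^esub> (F g)" for z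
  define b where "b z = inv\<^bsub>H\<^esub> (c g h) \<otimes>\<^bsub>H\<^esub> c (g \<otimes>\<^bsub>G\<^esub> h) z \<otimes>\<^bsub>H\<^esub> c g h" for z
  have cl: "e z \<in> carrier H" "b z \<in> carrier H" if "z \<in> carrier G" for z
    using g h that by (simp_all add: e_def b_def)
  have eb: "b z = c g z \<otimes>\<^bsub>H\<^esub> e z" if "z \<in> carrier G" for z
    using conj_c[OF g h that] g h that by (simp add: e_def b_def H.word_simps)
  have b: "b (x \<otimes>\<^bsub>G\<^esub> y) = b x \<otimes>\<^bsub>H\<^esub> b y"
    using g h x y by (simp add: b_def c_mult H.word_simps)
  have e: "e (x \<otimes>\<^bsub>G\<^esub> y) = e x \<otimes>\<^bsub>H\<^esub> e y"
    using g h x y by (simp add: e_def c_mult H.word_simps)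
  have "c g x \<otimes>\<^bsub>H\<^esub> (c g y \<otimes>\<^bsub>H\<^esub> e x \<otimes>\<^bsub>H\<^esub> e y) = c g x \<otimes>\<^bsub>H\<^esub> (e x \<otimes>\<^bsub>H\<^esub> c g y \<otimes>\<^bsub>H\<^esub> e y)"
    using b g h x y cl by (simp add: eb e c_mult H.m_assoc)
  then have "c g y \<otimes>\<^bsub>H\<^esub> e x \<otimes>\<^bsub>H\<^esub> e y = e x \<otimes>\<^bsub>H\<^esub> c g y \<otimes>\<^bsub>H\<^esub> e y"
    using g x y cl by (simp del: H.m_assoc)
  then show ?thesis unfolding e_def[symmetric] using g x y cl by (simp del: H.m_assoc)
qed

section \<open>The subgroup generated by the defects: invariance, commutativity, finiteness\<close>

definition C :: "'b set" where "C = (\<Union>g\<in>carrier G. c g ` carrier G)"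

abbreviation N :: "'b set" where "N \<equiv> generate H C"

lemma C_closed: "C \<subseteq> carrier H"
  by (auto simp: C_def)

lemma c_in_N: "g \<in> carrier G \<Longrightarrow> x \<in> carrier G \<Longrightarrow> c g x \<in> N"
  by (auto simp: C_def intro: generate.incl)

lemma N_subgroup: "subgroup N H"
  by (rule H.generate_is_subgroup[OF C_closed])

text \<open>By \<open>conj_c\<close>, the conjugate of a generator is a word in values of
  \<open>c\<close>.\<close>

lemma N_conj:
  assumes g: "g \<in> carrier G" and t: "t \<in> N"
  shows "F g \<otimes>\<^bsub>H\<^esub> t \<otimes>\<^bsub>H\<^esub> inv\<^bsub>H\<^esub> (F g) \<in> N"
proof (rule H.generate_conj_closed[OF C_closed _ _ t])
  interpret N: subgroup N H by (rule N_subgroup)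
  fix s assume "s \<in> C"
  then obtain h x where "s = c h x" "h \<in> carrier G" "x \<in> carrier G" by (auto simp: C_def)
  then show "F g \<otimes>\<^bsub>H\<^esub> s \<otimes>\<^bsub>H\<^esub> inv\<^bsub>H\<^esub> (F g) \<in> N"
    using g by (auto simp: conj_c intro!: N.m_closed N.m_inv_closed c_in_N)
qed (use g in simp)

text \<open>Expanding \<open>F\<close> at the product of \<open>g\<close> and its inverse gives a
  product equal to 1, which is then rotated cyclically.\<close>

lemma inv_F:
  assumes g: "g \<in> carrier G"
  shows "inv\<^bsub>H\<^esub> (F g) = F (inv\<^bsub>G\<^esub> g) \<otimes>\<^bsub>H\<^esub> c g (inv\<^bsub>G\<^esub> g)"
proof (rule H.inv_equality)
  have "c g (inv\<^bsub>G\<^esub> g) \<otimes>\<^bsub>H\<^esub> F g \<otimes>\<^bsub>H\<^esub> F (inv\<^bsub>G\<^esub> g) = \<one>\<^bsub>H\<^esub>"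
    using g F_mult[of g "inv\<^bsub>G\<^esub> g"] by simp
  then have "F (inv\<^bsub>G\<^esub> g) \<otimes>\<^bsub>H\<^esub> (c g (inv\<^bsub>G\<^esub> g) \<otimes>\<^bsub>H\<^esub> F g) = \<one>\<^bsub>H\<^esub>"
    using g H.inv_comm[of "c g (inv\<^bsub>G\<^esub> g) \<otimes>\<^bsub>H\<^esub> F g" "F (inv\<^bsub>G\<^esub> g)"] by simp
  then show "F (inv\<^bsub>G\<^esub> g) \<otimes>\<^bsub>H\<^esub> c g (inv\<^bsub>G\<^esub> g) \<otimes>\<^bsub>H\<^esub> F g = \<one>\<^bsub>H\<^esub>"
    using g by (simp add: H.m_assoc)
qed (use g in simp_all)

text \<open>\<open>N_conj\<close> gives one inclusion only, and \<open>N\<close> is not yet known to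
  be finite. By \<open>inv_F\<close>, conjugation by the inverse of \<open>F g\<close> is
  conjugation by an element of \<open>N\<close> followed by conjugation by a value of
  \<open>F\<close>.\<close>

lemma N_conj_inv:
  assumes g: "g \<in> carrier G" and t: "t \<in> N"
  shows "inv\<^bsub>H\<^esub> (F g) \<otimes>\<^bsub>H\<^esub> t \<otimes>\<^bsub>H\<^esub> F g \<in> N"
proof -
  interpret N: subgroup N H by (rule N_subgroup)
  let ?k = "c g (inv\<^bsub>G\<^esub> g)"
  have k: "?k \<in> N" using g by (simp add: c_in_N)
  have tH: "t \<in> carrier H" using t by simp
  \<comment> \<open>The double inverse is kept so that \<open>inv_F\<close> rewrites both outer
    factors.\<close>
  have "inv\<^bsub>H\<^esub> (F g) \<otimes>\<^bsub>H\<^esub> t \<otimes>\<^bsub>H\<^esub> inv\<^bsub>H\<^esub> (inv\<^bsub>H\<^esub> (F g)) =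
    F (inv\<^bsub>G\<^esub> g) \<otimes>\<^bsub>H\<^esub> (?k \<otimes>\<^bsub>H\<^esub> t \<otimes>\<^bsub>H\<^esub> inv\<^bsub>H\<^esub> ?k) \<otimes>\<^bsub>H\<^esub> inv\<^bsub>H\<^esub> (F (inv\<^bsub>G\<^esub> g))"
    unfolding inv_F[OF g] using g tH by (simp add: H.word_simps)
  moreover have "\<dots> \<in> N" using g k t by (intro N_conj) auto
  ultimately show ?thesis using g by simp
qed

text \<open>For \<open>s = c g y\<close>, conjugating \<open>c_commutes_conj\<close> back by
  \<open>F g\<close> shows that \<open>?z\<close> centralises \<open>C\<close> and hence
  \<open>N\<close>. Since \<open>?t\<close> lies in \<open>N\<close> by \<open>N_conj_inv\<close>,
  \<open>?z\<close> and \<open>?t\<close> commute, and conjugation by \<open>F g\<close> returns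
  them to \<open>s\<close> and \<open>t\<close>.\<close>

lemma C_commute:
  assumes s: "s \<in> C" and t: "t \<in> C"
  shows "s \<otimes>\<^bsub>H\<^esub> t = t \<otimes>\<^bsub>H\<^esub> s"
proof -
  interpret N: subgroup N H by (rule N_subgroup)
  obtain g y where s: "s = c g y" and g: "g \<in> carrier G" and y: "y \<in> carrier G"
    using s by (auto simp: C_def)
  let ?z = "inv\<^bsub>H\<^esub> (F g) \<otimes>\<^bsub>H\<^esub> s \<otimes>\<^bsub>H\<^esub> F g"
  let ?t = "inv\<^bsub>H\<^esub> (F g) \<otimes>\<^bsub>H\<^esub> t \<otimes>\<^bsub>H\<^esub> F g"
  have sH: "s \<in> carrier H" using s g y by simp
  have tN: "t \<in> N" using t by (rule generate.incl)
  have tH: "t \<in> carrier H" using tN by simp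
  have "?z \<otimes>\<^bsub>H\<^esub> r = r \<otimes>\<^bsub>H\<^esub> ?z" if r: "r \<in> C" for r
  proof -
    obtain h x where r: "r = c h x" and h: "h \<in> carrier G" and x: "x \<in> carrier G"
      using r by (auto simp: C_def)
    have rH: "r \<in> carrier H" using r h x by simp
    have "?z \<otimes>\<^bsub>H\<^esub> r = inv\<^bsub>H\<^esub> (F g) \<otimes>\<^bsub>H\<^esub> (s \<otimes>\<^bsub>H\<^esub> (F g \<otimes>\<^bsub>H\<^esub> r \<otimes>\<^bsub>H\<^esub> inv\<^bsub>H\<^esub> (F g))) \<otimes>\<^bsub>H\<^esub> F g"
      using g sH rH by (simp add: H.word_simps)
    also have "\<dots> = inv\<^bsub>H\<^esub> (F g) \<otimes>\<^bsub>H\<^esub> ((F g \<otimes>\<^bsub>H\<^esub> r \<otimes>\<^bsub>H\<^esub> inv\<^bsub>H\<^esub> (F g)) \<otimes>\<^bsub>H\<^esub> s) \<otimes>\<^bsub>H\<^esub> F g"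
      using c_commutes_conj[OF g h x y] r s by simp
    also have "\<dots> = r \<otimes>\<^bsub>H\<^esub> ?z" using g sH rH by (simp add: H.word_simps)
    finally show ?thesis .
  qed
  then have *: "?z \<otimes>\<^bsub>H\<^esub> ?t = ?t \<otimes>\<^bsub>H\<^esub> ?z"
    using H.generate_commute[OF C_closed, of ?z ?t] N_conj_inv[OF g tN] g sH by simp
  have "s \<otimes>\<^bsub>H\<^esub> t = F g \<otimes>\<^bsub>H\<^esub> (?z \<otimes>\<^bsub>H\<^esub> ?t) \<otimes>\<^bsub>H\<^esub> inv\<^bsub>H\<^esub> (F g)"
    using g sH tH by (simp add: H.word_simps)
  also have "\<dots> = t \<otimes>\<^bsub>H\<^esub> s" unfolding * using g sH tH by (simp add: H.word_simps)
  finally show ?thesis .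
qed

text \<open>Each \<open>c g\<close> is a homomorphism, so its image is a finite subgroup; these
  images are indexed by the finite group itself.\<close>

lemma finite_N:
  assumes "finite (carrier G)"
  shows "finite N"
  unfolding C_def
proof (rule H.finite_generate_commuting[OF assms])
  fix g assume g: "g \<in> carrier G"
  interpret c: group_hom G H "c g"
    using g by unfold_locales (auto simp: hom_def c_mult)
  show "subgroup (c g ` carrier G) H" by (rule c.img_is_subgroup)
next
  show "x \<otimes>\<^bsub>H\<^esub> y = y \<otimes>\<^bsub>H\<^esub> x"
    if "x \<in> (\<Union>g\<in>carrier G. c g ` carrier G)" "y \<in> (\<Union>g\<in>carrier G. c g ` carrier G)" for x y
    using that unfolding C_def[symmetric] by (rule C_commute)
qed (use assms in simp)

text \<open>The finite set \<open>?X\<close> of products of an element of \<open>N\<close> and a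
  value of \<open>F\<close> contains the generators and their inverses and is closed under
  products.\<close>

lemma finite_generate_image:
  assumes fin: "finite (carrier G)"
  shows "finite (generate H (F ` carrier G))"
proof -
  interpret N: subgroup N H by (rule N_subgroup)
  let ?X = "(\<lambda>(n, g). n \<otimes>\<^bsub>H\<^esub> F g) ` (N \<times> carrier G)"
  have X: "n \<otimes>\<^bsub>H\<^esub> F g \<in> ?X" if "n \<in> N" "g \<in> carrier G" for n g using that by force
  have "generate H (F ` carrier G) \<subseteq> ?X"
  proof
    fix x assume "x \<in> generate H (F ` carrier G)"
    then show "x \<in> ?X"
    proof induction
      case one
      then show ?case using X[of "\<one>\<^bsub>H\<^esub>" "\<one>\<^bsub>G\<^esub>"] by simp
    next
      case (incl h)
      then show ?case using X[of "\<one>\<^bsub>H\<^esub>"] by auto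
    next
      case (inv h)
      then obtain g where h: "h = F g" and g: "g \<in> carrier G" by auto
      let ?n = "F (inv\<^bsub>G\<^esub> g) \<otimes>\<^bsub>H\<^esub> c g (inv\<^bsub>G\<^esub> g) \<otimes>\<^bsub>H\<^esub> inv\<^bsub>H\<^esub> (F (inv\<^bsub>G\<^esub> g))"
      have "inv\<^bsub>H\<^esub> h = ?n \<otimes>\<^bsub>H\<^esub> F (inv\<^bsub>G\<^esub> g)"
        using g h by (simp add: inv_F[OF g] H.word_simps)
      moreover have "?n \<in> N" using g by (intro N_conj c_in_N) auto
      ultimately show ?case using X g by simp
    next
      case (eng x y)
      then obtain n g k h where *: "x = n \<otimes>\<^bsub>H\<^esub> F g" "y = k \<otimes>\<^bsub>H\<^esub> F h"
        "n \<in> N" "k \<in> N" "g \<in> carrier G" "h \<in> carrier G" by auto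
      \<comment> \<open>Move \<open>k\<close> to the left past \<open>F g\<close> by conjugation,
        then replace \<open>F g\<close> times \<open>F h\<close> by the inverse defect times
        \<open>F\<close> of the product.\<close>
      let ?n = "n \<otimes>\<^bsub>H\<^esub> (F g \<otimes>\<^bsub>H\<^esub> k \<otimes>\<^bsub>H\<^esub> inv\<^bsub>H\<^esub> (F g)) \<otimes>\<^bsub>H\<^esub> inv\<^bsub>H\<^esub> (c g h)"
      have "n \<in> carrier H" "k \<in> carrier H" using * by auto
      then have "x \<otimes>\<^bsub>H\<^esub> y = ?n \<otimes>\<^bsub>H\<^esub> F (g \<otimes>\<^bsub>G\<^esub> h)"
        using * by (simp add: F_mult H.word_simps)
      moreover have "?n \<in> N"
        using * by (intro N.m_closed N.m_inv_closed N_conj c_in_N) auto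
      ultimately show ?case using X * by simp
    qed
  qed
  then show ?thesis using finite_N[OF fin] fin by (auto intro: finite_subset)
qed

end

section \<open>Hamming distance and stability of finite groups\<close>

lemma hamming_dist_eq:
  assumes "0 < n" "\<sigma> \<in> carrier (sym_group n)" "\<tau> \<in> carrier (sym_group n)"
  shows "hamming_dist n \<sigma> \<tau> = real (card {i \<in> {1..n}. \<sigma> i \<noteq> \<tau> i}) / real n"
proof -
  have s: "\<sigma> permutes {1..n}" using assms by (simp add: sym_group_carrier)
  have "(inv\<^bsub>sym_group n\<^esub> \<sigma> \<otimes>\<^bsub>sym_group n\<^esub> \<tau>) i = i \<longleftrightarrow> \<sigma> i = \<tau> i" for i
    using assms permutes_inv_eq[OF s] by (simp add: sym_group_mult)
  then have *: "hamming_dist n \<sigma> \<tau> = 1 - real (card {i \<in> {1..n}. \<sigma> i = \<tau> i}) / real n"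
    by (simp add: hamming_dist_def)
  have "{1..n} = {i \<in> {1..n}. \<sigma> i = \<tau> i} \<union> {i \<in> {1..n}. \<sigma> i \<noteq> \<tau> i}" by auto
  then have "n = card ({i \<in> {1..n}. \<sigma> i = \<tau> i} \<union> {i \<in> {1..n}. \<sigma> i \<noteq> \<tau> i})" by (metis card_atLeastAtMost diff_Suc_1)
  also have "\<dots> = card {i \<in> {1..n}. \<sigma> i = \<tau> i} + card {i \<in> {1..n}. \<sigma> i \<noteq> \<tau> i}"
    by (rule card_Un_disjoint) auto
  finally have "real n = real (card {i \<in> {1..n}. \<sigma> i = \<tau> i}) + real (card {i \<in> {1..n}. \<sigma> i \<noteq> \<tau> i})"
    by linarith
  then show ?thesis using * assms(1) by (simp add: field_simps)
qed

section \<open>Metric properties and bi-invariance of the Hamming distance\<close>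

context
  fixes n :: nat
  assumes n: "0 < n"
begin

interpretation S: group "sym_group n" by (rule sym_group_is_group)

lemma hamming_dist_nonneg:
  assumes "\<sigma> \<in> carrier (sym_group n)" "\<tau> \<in> carrier (sym_group n)"
  shows "0 \<le> hamming_dist n \<sigma> \<tau>"
  using assms n by (simp add: hamming_dist_eq)

lemma hamming_dist_sym:
  assumes "\<sigma> \<in> carrier (sym_group n)" "\<tau> \<in> carrier (sym_group n)"
  shows "hamming_dist n \<sigma> \<tau> = hamming_dist n \<tau> \<sigma>"
proof -
  have "{i \<in> {1..n}. \<sigma> i \<noteq> \<tau> i} = {i \<in> {1..n}. \<tau> i \<noteq> \<sigma> i}" by auto
  then show ?thesis using assms n by (simp add: hamming_dist_eq)
qed

lemma hamming_dist_triangle: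
  assumes "\<sigma> \<in> carrier (sym_group n)" "\<tau> \<in> carrier (sym_group n)" "\<kappa> \<in> carrier (sym_group n)"
  shows "hamming_dist n \<sigma> \<kappa> \<le> hamming_dist n \<sigma> \<tau> + hamming_dist n \<tau> \<kappa>"
proof -
  have "card {i \<in> {1..n}. \<sigma> i \<noteq> \<kappa> i} \<le> card ({i \<in> {1..n}. \<sigma> i \<noteq> \<tau> i} \<union> {i \<in> {1..n}. \<tau> i \<noteq> \<kappa> i})"
    by (rule card_mono) auto
  also have "\<dots> \<le> card {i \<in> {1..n}. \<sigma> i \<noteq> \<tau> i} + card {i \<in> {1..n}. \<tau> i \<noteq> \<kappa> i}"
    by (rule card_Un_le)
  finally have "real (card {i \<in> {1..n}. \<sigma> i \<noteq> \<kappa> i}) \<le> card {i \<in> {1..n}. \<sigma> i \<noteq> \<tau> i} + card {i \<in> {1..n}. \<tau> i \<noteq> \<kappa> i}"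
    by simp
  then show ?thesis using assms n by (simp add: hamming_dist_eq divide_right_mono flip: add_divide_distrib)
qed

lemma hamming_dist_mult_left:
  assumes "\<sigma> \<in> carrier (sym_group n)" "\<tau> \<in> carrier (sym_group n)" "\<kappa> \<in> carrier (sym_group n)"
  shows "hamming_dist n (\<kappa> \<otimes>\<^bsub>sym_group n\<^esub> \<sigma>) (\<kappa> \<otimes>\<^bsub>sym_group n\<^esub> \<tau>) = hamming_dist n \<sigma> \<tau>"
proof -
  have "inj \<kappa>" using assms permutes_inj by (auto simp: sym_group_carrier)
  then show ?thesis
    using assms n S.m_closed[OF assms(3,1)] S.m_closed[OF assms(3,2)]
    by (simp add: hamming_dist_eq sym_group_mult inj_eq)
qed

text \<open>\<open>\<kappa>\<close> maps the disagreement set of the two products bijectively onto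
  that of \<open>\<sigma>\<close> and \<open>\<tau>\<close>.\<close>

lemma hamming_dist_mult_right:
  assumes "\<sigma> \<in> carrier (sym_group n)" "\<tau> \<in> carrier (sym_group n)" "\<kappa> \<in> carrier (sym_group n)"
  shows "hamming_dist n (\<sigma> \<otimes>\<^bsub>sym_group n\<^esub> \<kappa>) (\<tau> \<otimes>\<^bsub>sym_group n\<^esub> \<kappa>) = hamming_dist n \<sigma> \<tau>"
proof -
  have k: "\<kappa> permutes {1..n}" using assms by (simp add: sym_group_carrier)
  have "bij_betw \<kappa> {i \<in> {1..n}. \<sigma> (\<kappa> i) \<noteq> \<tau> (\<kappa> i)} {i \<in> {1..n}. \<sigma> i \<noteq> \<tau> i}"
    unfolding bij_betw_def
  proof
    show "inj_on \<kappa> {i \<in> {1..n}. \<sigma> (\<kappa> i) \<noteq> \<tau> (\<kappa> i)}" using permutes_inj_on[OF k] .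
    show "\<kappa> ` {i \<in> {1..n}. \<sigma> (\<kappa> i) \<noteq> \<tau> (\<kappa> i)} = {i \<in> {1..n}. \<sigma> i \<noteq> \<tau> i}"
    proof (intro equalityI subsetI)
      fix i assume i: "i \<in> {i \<in> {1..n}. \<sigma> i \<noteq> \<tau> i}"
      then obtain j where "j \<in> {1..n}" "i = \<kappa> j" using permutes_image[OF k] by blast
      then show "i \<in> \<kappa> ` {i \<in> {1..n}. \<sigma> (\<kappa> i) \<noteq> \<tau> (\<kappa> i)}" using i by auto
    qed (use permutes_in_image[OF k] in auto)
  qed
  then show ?thesis
    using assms n S.m_closed[OF assms(1,3)] S.m_closed[OF assms(2,3)] bij_betw_same_card
    by (auto simp: hamming_dist_eq sym_group_mult)
qed

end

text \<open>The points at which an almost homomorphism is multiplicative form a set invariant under all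
  its values, and it acts on this set by an honest homomorphism.\<close>

lemma hom_near_almost_hom:
  fixes K :: "('a, 'c) monoid_scheme" (structure)
  assumes "group K" and fin: "finite (carrier K)" and n: "0 < n"
    and \<phi>: "\<phi> \<in> carrier K \<rightarrow> carrier (sym_group n)"
  shows "\<exists>\<psi>\<in>hom K (sym_group n). \<forall>\<gamma>\<in>carrier K. hamming_dist n (\<psi> \<gamma>) (\<phi> \<gamma>) \<le>
    (\<Sum>(\<alpha>, \<beta>)\<in>carrier K \<times> carrier K. hamming_dist n (\<phi> (\<alpha> \<otimes> \<beta>)) (\<phi> \<alpha> \<otimes>\<^bsub>sym_group n\<^esub> \<phi> \<beta>))"
proof -
  interpret K: group K by fact
  interpret S: group "sym_group n" by (rule sym_group_is_group)
  have perm: "\<phi> k permutes {1..n}" if "k \<in> carrier K" for k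
    using \<phi> that by (auto simp: sym_group_carrier)
  define A where "A = {i \<in> {1..n}. \<forall>\<alpha>\<in>carrier K. \<forall>\<beta>\<in>carrier K. \<phi> (\<alpha> \<otimes> \<beta>) i = \<phi> \<alpha> (\<phi> \<beta> i)}"
  have A: "\<phi> (\<alpha> \<otimes> \<beta>) i = \<phi> \<alpha> (\<phi> \<beta> i)" if "i \<in> A" "\<alpha> \<in> carrier K" "\<beta> \<in> carrier K" for \<alpha> \<beta> i
    using that by (simp add: A_def)
  have A_range: "A \<subseteq> {1..n}" by (auto simp: A_def)
  have inv: "\<phi> k i \<in> A" if i: "i \<in> A" and k: "k \<in> carrier K" for i k
    unfolding A_def
  proof (intro CollectI conjI ballI)
    show "\<phi> k i \<in> {1..n}" using permutes_in_image[OF perm[OF k]] i A_range by blast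
    fix \<alpha> \<beta> assume ab: "\<alpha> \<in> carrier K" "\<beta> \<in> carrier K"
    \<comment> \<open>Invariance of \<open>A\<close> is associativity in \<open>K\<close>, read
      through multiplicativity at \<open>i\<close> for three pairs.\<close>
    have "\<phi> (\<alpha> \<otimes> \<beta>) (\<phi> k i) = \<phi> (\<alpha> \<otimes> \<beta> \<otimes> k) i" using A[OF i, of "\<alpha> \<otimes> \<beta>" k] ab k by simp
    also have "\<dots> = \<phi> (\<alpha> \<otimes> (\<beta> \<otimes> k)) i" using ab k by (simp add: K.m_assoc)
    also have "\<dots> = \<phi> \<alpha> (\<phi> (\<beta> \<otimes> k) i)" using A[OF i, of \<alpha> "\<beta> \<otimes> k"] ab k by simp
    also have "\<dots> = \<phi> \<alpha> (\<phi> \<beta> (\<phi> k i))" using A[OF i, of \<beta> k] ab k by simp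
    finally show "\<phi> (\<alpha> \<otimes> \<beta>) (\<phi> k i) = \<phi> \<alpha> (\<phi> \<beta> (\<phi> k i))" .
  qed
  \<comment> \<open>Acting trivially off \<open>A\<close> gives a permutation of all of
    \<open>{1..n}\<close> and keeps \<open>\<psi>\<close> multiplicative there.\<close>
  define \<psi> where "\<psi> k i = (if i \<in> A then \<phi> k i else i)" for k i
  have "\<psi> k permutes {1..n}" if k: "k \<in> carrier K" for k
  proof -
    have inj: "inj_on (\<phi> k) A" using permutes_inj_on[OF perm[OF k]] .
    moreover have "\<phi> k ` A = A"
      using inv[OF _ k] inj A_range by (intro endo_inj_surj) (auto intro: finite_subset)
    ultimately have "bij_betw (\<psi> k) A A"
      by (simp add: bij_betw_def \<psi>_def cong: inj_on_cong)
    then have "\<psi> k permutes A" by (rule bij_imp_permutes) (simp add: \<psi>_def)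
    then show ?thesis by (rule permutes_subset[OF _ A_range])
  qed
  then have \<psi>: "\<psi> k \<in> carrier (sym_group n)" if "k \<in> carrier K" for k
    using that by (simp add: sym_group_carrier)
  have "\<psi> \<in> hom K (sym_group n)"
    by (rule homI) (auto simp: \<psi> sym_group_mult fun_eq_iff \<psi>_def A inv)
  moreover have "hamming_dist n (\<psi> \<gamma>) (\<phi> \<gamma>) \<le>
      (\<Sum>(\<alpha>, \<beta>)\<in>carrier K \<times> carrier K. hamming_dist n (\<phi> (\<alpha> \<otimes> \<beta>)) (\<phi> \<alpha> \<otimes>\<^bsub>sym_group n\<^esub> \<phi> \<beta>))"
    if \<gamma>: "\<gamma> \<in> carrier K" for \<gamma>
  proof -
    \<comment> \<open>\<open>\<psi> \<gamma>\<close> and \<open>\<phi> \<gamma>\<close> can differ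
      only off \<open>A\<close>, where multiplicativity fails for some pair; a union bound over
      pairs follows.\<close>
    let ?B = "\<lambda>(\<alpha>, \<beta>). {i \<in> {1..n}. \<phi> (\<alpha> \<otimes> \<beta>) i \<noteq> \<phi> \<alpha> (\<phi> \<beta> i)}"
    have "card {i \<in> {1..n}. \<psi> \<gamma> i \<noteq> \<phi> \<gamma> i} \<le> card (\<Union>p\<in>carrier K \<times> carrier K. ?B p)"
      using fin by (intro card_mono) (auto simp: \<psi>_def A_def)
    also have "\<dots> \<le> (\<Sum>p\<in>carrier K \<times> carrier K. card (?B p))"
      using fin by (intro card_UN_le) simp
    finally have "real (card {i \<in> {1..n}. \<psi> \<gamma> i \<noteq> \<phi> \<gamma> i}) / n \<le>
        real (\<Sum>p\<in>carrier K \<times> carrier K. card (?B p)) / n"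
      by (intro divide_right_mono of_nat_mono) simp_all
    also have "\<dots> = (\<Sum>p\<in>carrier K \<times> carrier K. real (card (?B p)) / n)"
      by (simp add: sum_divide_distrib)
    also have "\<dots> = (\<Sum>(\<alpha>, \<beta>)\<in>carrier K \<times> carrier K.
        hamming_dist n (\<phi> (\<alpha> \<otimes> \<beta>)) (\<phi> \<alpha> \<otimes>\<^bsub>sym_group n\<^esub> \<phi> \<beta>))"
    proof (intro sum.cong refl)
      fix p assume p: "p \<in> carrier K \<times> carrier K"
      obtain \<alpha> \<beta> where p': "p = (\<alpha>, \<beta>)" by fastforce
      have "\<phi> \<alpha> \<in> carrier (sym_group n)" "\<phi> \<beta> \<in> carrier (sym_group n)" "\<phi> (\<alpha> \<otimes> \<beta>) \<in> carrier (sym_group n)"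
        using p p' \<phi> by auto
      then show "real (card (?B p)) / n =
          (case p of (\<alpha>, \<beta>) \<Rightarrow> hamming_dist n (\<phi> (\<alpha> \<otimes> \<beta>)) (\<phi> \<alpha> \<otimes>\<^bsub>sym_group n\<^esub> \<phi> \<beta>))"
        using p' S.m_closed[of "\<phi> \<alpha>" "\<phi> \<beta>"] by (simp add: hamming_dist_eq[OF n] sym_group_mult)
    qed
    finally show ?thesis
      using hamming_dist_eq[OF n \<psi>[OF \<gamma>]] \<phi> \<gamma> by (simp add: Pi_iff)
  qed
  ultimately show ?thesis by blast
qed

text \<open>The bound of \<open>hom_near_almost_hom\<close> does not depend on the group element,
  and it is a sum of null sequences over the finitely many pairs.\<close>

lemma finite_group_stable:
  fixes K :: "('a, 'c) monoid_scheme" (structure)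
  assumes "group K" and fin: "finite (carrier K)" and m: "\<And>n. 0 < m n"
    and \<phi>: "\<And>n. \<phi> n \<in> carrier K \<rightarrow> carrier (sym_group (m n))"
    and lim: "\<And>\<alpha> \<beta>. \<alpha> \<in> carrier K \<Longrightarrow> \<beta> \<in> carrier K \<Longrightarrow>
      (\<lambda>n. hamming_dist (m n) (\<phi> n (\<alpha> \<otimes> \<beta>)) (\<phi> n \<alpha> \<otimes>\<^bsub>sym_group (m n)\<^esub> \<phi> n \<beta>)) \<longlonglongrightarrow> 0"
  obtains \<psi> where "\<And>n. \<psi> n \<in> hom K (sym_group (m n))"
    and "\<And>\<gamma>. \<gamma> \<in> carrier K \<Longrightarrow> (\<lambda>n. hamming_dist (m n) (\<psi> n \<gamma>) (\<phi> n \<gamma>)) \<longlonglongrightarrow> 0"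
proof -
  define D where "D n = (\<Sum>(\<alpha>, \<beta>)\<in>carrier K \<times> carrier K.
    hamming_dist (m n) (\<phi> n (\<alpha> \<otimes> \<beta>)) (\<phi> n \<alpha> \<otimes>\<^bsub>sym_group (m n)\<^esub> \<phi> n \<beta>))" for n
  have "\<forall>n. \<exists>\<psi>\<in>hom K (sym_group (m n)). \<forall>\<gamma>\<in>carrier K. hamming_dist (m n) (\<psi> \<gamma>) (\<phi> n \<gamma>) \<le> D n"
    unfolding D_def using hom_near_almost_hom[OF assms(1) fin m \<phi>] by blast
  then obtain \<psi> where \<psi>: "\<And>n. \<psi> n \<in> hom K (sym_group (m n))"
    and le: "\<And>n \<gamma>. \<gamma> \<in> carrier K \<Longrightarrow> hamming_dist (m n) (\<psi> n \<gamma>) (\<phi> n \<gamma>) \<le> D n"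
    by metis
  have "D \<longlonglongrightarrow> (\<Sum>p\<in>carrier K \<times> carrier K. 0)"
    unfolding D_def using lim by (intro tendsto_sum) auto
  then have D: "D \<longlonglongrightarrow> 0" by simp
  have "(\<lambda>n. hamming_dist (m n) (\<psi> n \<gamma>) (\<phi> n \<gamma>)) \<longlonglongrightarrow> 0" if \<gamma>: "\<gamma> \<in> carrier K" for \<gamma>
  proof (rule tendsto_sandwich[OF _ _ tendsto_const D])
    show "\<forall>\<^sub>F n in sequentially. 0 \<le> hamming_dist (m n) (\<psi> n \<gamma>) (\<phi> n \<gamma>)"
      using hamming_dist_nonneg[OF m] \<phi> hom_carrier[OF \<psi>] \<gamma> by (auto simp: Pi_iff image_subset_iff)
  qed (use le \<gamma> in auto)
  then show thesis using that \<psi> by blast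
qed

section \<open>Sequences of permutations modulo null sequences\<close>

locale sym_sequences =
  fixes m :: "nat \<Rightarrow> nat"
  assumes m: "0 < m n"
begin

definition P :: "(nat \<Rightarrow> nat \<Rightarrow> nat) monoid" where
  "P = product_group UNIV (\<lambda>n. sym_group (m n))"

definition null :: "(nat \<Rightarrow> nat \<Rightarrow> nat) set" where
  "null = {a \<in> carrier P. (\<lambda>n. hamming_dist (m n) (a n) \<one>\<^bsub>sym_group (m n)\<^esub>) \<longlonglongrightarrow> 0}"

sublocale S: group "sym_group (m n)" for n
  by (rule sym_group_is_group)

sublocale P: group P
  unfolding P_def by (simp add: sym_group_is_group)

lemma mem_P: "a \<in> carrier P \<longleftrightarrow> (\<forall>n. a n \<in> carrier (sym_group (m n)))"
  by (auto simp: P_def)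

lemma P_mult [simp]: "(a \<otimes>\<^bsub>P\<^esub> b) n = a n \<otimes>\<^bsub>sym_group (m n)\<^esub> b n"
  by (simp add: P_def)

lemma P_one [simp]: "\<one>\<^bsub>P\<^esub> n = \<one>\<^bsub>sym_group (m n)\<^esub>"
  by (simp add: P_def)

lemma P_inv [simp]: "a \<in> carrier P \<Longrightarrow> (inv\<^bsub>P\<^esub> a) n = inv\<^bsub>sym_group (m n)\<^esub> (a n)"
  by (simp add: P_def sym_group_is_group)

lemma component_hom: "(\<lambda>a. a n) \<in> hom P (sym_group (m n))"
  by (rule homI) (auto simp: mem_P)

lemma null_dist_le:
  assumes "\<And>n. a n \<in> carrier (sym_group (m n))" "\<And>n. b n \<in> carrier (sym_group (m n))"
    and "\<And>n. hamming_dist (m n) (a n) (b n) \<le> e n" and "e \<longlonglongrightarrow> 0"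
  shows "(\<lambda>n. hamming_dist (m n) (a n) (b n)) \<longlonglongrightarrow> 0"
  by (rule tendsto_sandwich[OF _ _ tendsto_const assms(4)])
    (use assms hamming_dist_nonneg[OF m] in auto)

text \<open>Bi-invariance of the distance does the work: left invariance and symmetry handle
  inverses, right invariance and the triangle inequality handle products, and both invariances
  together handle conjugates.\<close>

lemma null_normal: "null \<lhd> P"
proof (rule P.normal_invI)
  show "subgroup null P"
  proof (rule P.subgroupI)
    show "null \<noteq> {}" using m by (auto simp: null_def hamming_dist_eq intro!: exI[of _ "\<one>\<^bsub>P\<^esub>"])
  next
    fix a assume "a \<in> null"
    then have a: "\<And>n. a n \<in> carrier (sym_group (m n))" "a \<in> carrier P"
      and lim: "(\<lambda>n. hamming_dist (m n) (a n) \<one>\<^bsub>sym_group (m n)\<^esub>) \<longlonglongrightarrow> 0"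
      by (auto simp: null_def mem_P)
    have "hamming_dist (m n) (inv\<^bsub>sym_group (m n)\<^esub> (a n)) \<one>\<^bsub>sym_group (m n)\<^esub>
        = hamming_dist (m n) (a n) \<one>\<^bsub>sym_group (m n)\<^esub>" for n
      using hamming_dist_mult_left[OF m S.one_closed a(1) S.inv_closed[OF a(1)], of n]
        hamming_dist_sym[OF m a(1) S.one_closed, of n] a(1)
      by (simp del: sym_group_inv_equality)
    then show "inv\<^bsub>P\<^esub> a \<in> null" using a lim by (simp add: null_def del: sym_group_inv_equality)
  next
    fix a b assume "a \<in> null" "b \<in> null"
    then have a: "\<And>n. a n \<in> carrier (sym_group (m n))" "a \<in> carrier P"
      and b: "\<And>n. b n \<in> carrier (sym_group (m n))" "b \<in> carrier P"
      and lim: "(\<lambda>n. hamming_dist (m n) (a n) \<one>\<^bsub>sym_group (m n)\<^esub>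
        + hamming_dist (m n) (b n) \<one>\<^bsub>sym_group (m n)\<^esub>) \<longlonglongrightarrow> 0"
      by (auto simp: null_def mem_P intro: tendsto_add_zero)
    have "hamming_dist (m n) (a n \<otimes>\<^bsub>sym_group (m n)\<^esub> b n) \<one>\<^bsub>sym_group (m n)\<^esub>
        \<le> hamming_dist (m n) (a n) \<one>\<^bsub>sym_group (m n)\<^esub> + hamming_dist (m n) (b n) \<one>\<^bsub>sym_group (m n)\<^esub>" for n
      using hamming_dist_triangle[OF m S.m_closed[OF a(1) b(1)] b(1) S.one_closed, of n]
        hamming_dist_mult_right[OF m a(1) S.one_closed b(1), of n] b(1)
      by simp
    then show "a \<otimes>\<^bsub>P\<^esub> b \<in> null"
      using a b null_dist_le[OF _ _ _ lim, of "a \<otimes>\<^bsub>P\<^esub> b"] by (simp add: null_def)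
  qed (auto simp: null_def)
next
  fix g a assume g: "g \<in> carrier P" and "a \<in> null"
  then have a: "\<And>n. a n \<in> carrier (sym_group (m n))" "a \<in> carrier P"
    and lim: "(\<lambda>n. hamming_dist (m n) (a n) \<one>\<^bsub>sym_group (m n)\<^esub>) \<longlonglongrightarrow> 0"
    by (auto simp: null_def mem_P)
  have g': "g n \<in> carrier (sym_group (m n))" for n using g by (simp add: mem_P)
  \<comment> \<open>The identity is read as the conjugate of the identity by \<open>g n\<close>,
    after which both outer factors are stripped.\<close>
  have "hamming_dist (m n) (g n \<otimes>\<^bsub>sym_group (m n)\<^esub> a n \<otimes>\<^bsub>sym_group (m n)\<^esub> inv\<^bsub>sym_group (m n)\<^esub> (g n)) \<one>\<^bsub>sym_group (m n)\<^esub>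
      = hamming_dist (m n) (a n) \<one>\<^bsub>sym_group (m n)\<^esub>" for n
    using hamming_dist_mult_right[OF m S.m_closed[OF g' a(1)] S.m_closed[OF g' S.one_closed] S.inv_closed[OF g'], of n]
      hamming_dist_mult_left[OF m a(1) S.one_closed g', of n] g'
    by (simp del: sym_group_inv_equality)
  then show "g \<otimes>\<^bsub>P\<^esub> a \<otimes>\<^bsub>P\<^esub> inv\<^bsub>P\<^esub> g \<in> null"
    using a g lim by (simp add: null_def del: sym_group_inv_equality)
qed

sublocale null: normal null P
  by (rule null_normal)

text \<open>This is the metric reduced product of the symmetric groups along the cofinite filter;
  ordinary limits make an ultrafilter unnecessary.\<close>

definition Q :: "(nat \<Rightarrow> nat \<Rightarrow> nat) set monoid" where "Q = P Mod null"

definition cls :: "(nat \<Rightarrow> nat \<Rightarrow> nat) \<Rightarrow> (nat \<Rightarrow> nat \<Rightarrow> nat) set" where "cls a = null #>\<^bsub>P\<^esub> a"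

sublocale Q: group Q
  unfolding Q_def by (rule null.factorgroup_is_group)

sublocale cls: group_hom P Q cls
  by unfold_locales (use null.r_coset_hom_Mod in \<open>simp add: Q_def cls_def[abs_def]\<close>)

lemma cls_surj: "X \<in> carrier Q \<Longrightarrow> \<exists>a\<in>carrier P. cls a = X"
  by (auto simp: Q_def cls_def carrier_FactGroup)

lemma cls_null: "a \<in> null \<Longrightarrow> cls a = \<one>\<^bsub>Q\<^esub>"
  using P.coset_join2[OF null.mem_carrier null.subgroup_axioms] by (simp add: cls_def Q_def)

text \<open>Elements of one coset differ by a null factor on the left, and right invariance cancels
  the common factor. Thus equality in the quotient becomes asymptotic closeness.\<close>

lemma cls_eqD:
  assumes a: "a \<in> carrier P" and b: "b \<in> carrier P" and eq: "cls a = cls b"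
  shows "(\<lambda>n. hamming_dist (m n) (a n) (b n)) \<longlonglongrightarrow> 0"
proof -
  have "a \<in> null #>\<^bsub>P\<^esub> b"
    using P.rcos_self[OF a null.subgroup_axioms] eq by (simp add: cls_def)
  then obtain t where t: "t \<in> null" "a = t \<otimes>\<^bsub>P\<^esub> b" by (auto simp: r_coset_def)
  have t': "t n \<in> carrier (sym_group (m n))" "b n \<in> carrier (sym_group (m n))" for n
    using null.mem_carrier[OF t(1)] b by (simp_all add: mem_P)
  have "hamming_dist (m n) (a n) (b n) = hamming_dist (m n) (t n) \<one>\<^bsub>sym_group (m n)\<^esub>" for n
    using hamming_dist_mult_right[OF m t'(1) S.one_closed t'(2), of n] t' t by simp
  moreover have "(\<lambda>n. hamming_dist (m n) (t n) \<one>\<^bsub>sym_group (m n)\<^esub>) \<longlonglongrightarrow> 0"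
    using t(1) unfolding null_def by blast
  ultimately show ?thesis by simp
qed

end

section \<open>Descent to a finite subgroup of the quotient and return to permutations\<close>

theorem corollary4p1:
  fixes G :: "('a, 'c) monoid_scheme"
  assumes "group G"
    and "finite (carrier G)"
  shows "P_stable 2 G"
  unfolding P_stable_def
proof (intro allI impI)
  fix m f assume ap: "almost_polynomial G 2 m f"
  interpret G: group G by fact
  interpret sym_sequences m
    using ap by unfold_locales (simp add: almost_polynomial_def asymptotically_unital_def)
  have f: "f n \<in> carrier G \<rightarrow> carrier (sym_group (m n))" for n
    using ap by (simp add: almost_polynomial_def asymptotically_unital_def)
  define s where "s g = (\<lambda>n. f n g)" for g
  have s: "s \<in> carrier G \<rightarrow> carrier P" using f by (simp add: s_def mem_P Pi_iff)
  define F where "F g = cls (s g)" for g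
  have F: "F g \<in> carrier Q" if "g \<in> carrier G" for g using s that by (simp add: F_def Pi_iff)
  have comp: "iter_diff G P gs s \<one>\<^bsub>G\<^esub> n = iter_diff G (sym_group (m n)) gs (f n) \<one>\<^bsub>G\<^esub>"
    if "set gs \<subseteq> carrier G" for gs n
    using iter_diff_hom[OF G.group_axioms P.group_axioms S.group_axioms component_hom s that, of "\<one>\<^bsub>G\<^esub>" n]
    by (simp add: s_def)
  \<comment> \<open>The asymptotic hypothesis puts third differences at 1 into \<open>null\<close>,
    so they vanish exactly in \<open>Q\<close>.\<close>
  have poly: "polynomial_map G Q 2 F"
  proof (rule polynomial_mapI_at_one[OF G.group_axioms Q.group_axioms])
    fix gs :: "'a list" assume gs: "set gs \<subseteq> carrier G" "length gs = 2 + 1"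
    have "(\<lambda>n. hamming_dist (m n) (iter_diff G P gs s \<one>\<^bsub>G\<^esub> n) \<one>\<^bsub>sym_group (m n)\<^esub>) \<longlonglongrightarrow> 0"
      using ap gs by (simp add: comp almost_polynomial_def)
    moreover have "iter_diff G P gs s \<one>\<^bsub>G\<^esub> \<in> carrier P"
      by (rule funcset_mem[OF iter_diff_closed[OF G.group_axioms P.group_axioms s gs(1)] G.one_closed])
    ultimately have "iter_diff G P gs s \<one>\<^bsub>G\<^esub> \<in> null"
      unfolding null_def by blast
    then show "iter_diff G Q gs F \<one>\<^bsub>G\<^esub> = \<one>\<^bsub>Q\<^esub>"
      using iter_diff_hom[OF G.group_axioms P.group_axioms Q.group_axioms cls.homh s gs(1), of "\<one>\<^bsub>G\<^esub>"]
      by (simp add: F_def[abs_def] cls_null)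
  qed (use F in auto)
  have unital: "unital_map G Q F"
  proof -
    have "s \<one>\<^bsub>G\<^esub> \<in> carrier P" using s by (rule funcset_mem) simp
    moreover have "(\<lambda>n. hamming_dist (m n) (s \<one>\<^bsub>G\<^esub> n) \<one>\<^bsub>sym_group (m n)\<^esub>) \<longlonglongrightarrow> 0"
      using ap by (simp add: almost_polynomial_def asymptotically_unital_def s_def)
    ultimately have "s \<one>\<^bsub>G\<^esub> \<in> null" unfolding null_def by blast
    then show ?thesis by (simp add: unital_map_def F_def cls_null)
  qed
  interpret unital_quadratic G Q F
    using poly unital by unfold_locales
  define K where "K = Q\<lparr>carrier := generate Q (F ` carrier G)\<rparr>"
  have sub: "subgroup (generate Q (F ` carrier G)) Q"
    using F by (intro Q.generate_is_subgroup) auto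
  have K_carrier: "carrier K \<subseteq> carrier Q" using subgroup.subset[OF sub] by (simp add: K_def)
  have K: "group K" unfolding K_def by (rule Q.subgroup_imp_group[OF sub])
  have finK: "finite (carrier K)" using finite_generate_image[OF assms(2)] by (simp add: K_def)
  have FK: "F g \<in> carrier K" if "g \<in> carrier G" for g
    using that by (auto simp: K_def intro: generate.incl)
  \<comment> \<open>Differences computed in \<open>K\<close> and in \<open>Q\<close> are compared
    through the inclusion homomorphism.\<close>
  have incl: "(\<lambda>x. x) \<in> hom K Q" using K_carrier by (auto simp: hom_def K_def)
  have polyK: "polynomial_map G K 2 F"
    using poly FK iter_diff_hom[OF G.group_axioms K Q.group_axioms incl, of F]
    by (auto simp: polynomial_map_def K_def)
  \<comment> \<open>An arbitrary section of \<open>cls\<close>. It need not be multiplicative, but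
    \<open>rep\<close> of a product and the product of the \<open>rep\<close> values share a class,
    so its coordinates are asymptotically multiplicative.\<close>
  define rep where "rep X = (SOME a. a \<in> carrier P \<and> cls a = X)" for X
  have rep: "rep X \<in> carrier P" "cls (rep X) = X" if "X \<in> carrier Q" for X
    using someI_ex[of "\<lambda>a. a \<in> carrier P \<and> cls a = X"] cls_surj[OF that] by (auto simp: rep_def)
  obtain \<psi> where \<psi>: "\<And>n. \<psi> n \<in> hom K (sym_group (m n))"
    and lim: "\<And>X. X \<in> carrier K \<Longrightarrow> (\<lambda>n. hamming_dist (m n) (\<psi> n X) (rep X n)) \<longlonglongrightarrow> 0"
  proof (rule finite_group_stable[OF K finK m, of "\<lambda>n X. rep X n"])
    show "(\<lambda>X. rep X n) \<in> carrier K \<rightarrow> carrier (sym_group (m n))" for n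
      using rep K_carrier by (auto simp: mem_P)
    fix X Y assume "X \<in> carrier K" "Y \<in> carrier K"
    then have XY: "X \<in> carrier Q" "Y \<in> carrier Q" using K_carrier by auto
    have "cls (rep (X \<otimes>\<^bsub>Q\<^esub> Y)) = cls (rep X \<otimes>\<^bsub>P\<^esub> rep Y)" using XY rep by simp
    then show "(\<lambda>n. hamming_dist (m n) (rep (X \<otimes>\<^bsub>K\<^esub> Y) n) (rep X n \<otimes>\<^bsub>sym_group (m n)\<^esub> rep Y n)) \<longlonglongrightarrow> 0"
      using cls_eqD[of "rep (X \<otimes>\<^bsub>Q\<^esub> Y)" "rep X \<otimes>\<^bsub>P\<^esub> rep Y"] XY rep by (simp add: K_def)
  qed blast
  show "\<exists>\<rho>. (\<forall>n. unital_map G (sym_group (m n)) (\<rho> n) \<and> polynomial_map G (sym_group (m n)) 2 (\<rho> n)) \<and>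
      (\<forall>g\<in>carrier G. (\<lambda>n. hamming_dist (m n) (\<rho> n g) (f n g)) \<longlonglongrightarrow> 0)"
  proof (intro exI[of _ "\<lambda>n g. \<psi> n (F g)"] conjI allI ballI)
    fix n
    have "\<psi> n \<one>\<^bsub>K\<^esub> = \<one>\<^bsub>sym_group (m n)\<^esub>"
      by (rule hom_one[OF \<psi> K S.group_axioms])
    then show "unital_map G (sym_group (m n)) (\<lambda>g. \<psi> n (F g))"
      using unital by (simp add: unital_map_def K_def)
    show "polynomial_map G (sym_group (m n)) 2 (\<lambda>g. \<psi> n (F g))"
      by (rule polynomial_map_hom[OF G.group_axioms K S.group_axioms \<psi> polyK])
  next
    fix g assume g: "g \<in> carrier G"
    have c1: "\<psi> n (F g) \<in> carrier (sym_group (m n))" for n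
      using hom_carrier[OF \<psi>, of n] FK[OF g] by auto
    have c2: "rep (F g) n \<in> carrier (sym_group (m n))" for n
      using rep F[OF g] by (auto simp: mem_P)
    have c3: "f n g \<in> carrier (sym_group (m n))" for n using f g by auto
    \<comment> \<open>The chosen representative and the given sequence have the same class
      \<open>F g\<close>; the triangle inequality through \<open>rep (F g)\<close> finishes the
      estimate.\<close>
    have "(\<lambda>n. hamming_dist (m n) (rep (F g) n) (s g n)) \<longlonglongrightarrow> 0"
      using rep F[OF g] s g by (intro cls_eqD) (auto simp: F_def)
    then have "(\<lambda>n. hamming_dist (m n) (\<psi> n (F g)) (rep (F g) n) + hamming_dist (m n) (rep (F g) n) (f n g)) \<longlonglongrightarrow> 0"
      using lim[OF FK[OF g]] by (auto simp: s_def intro: tendsto_add_zero)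
    then show "(\<lambda>n. hamming_dist (m n) (\<psi> n (F g)) (f n g)) \<longlonglongrightarrow> 0"
      using hamming_dist_triangle[OF m c1 c2 c3] by (intro null_dist_le c1 c3)
  qed
qed

end
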